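(* Let $n\ge 1$, let $g_1,\dots,g_{n+2}\in\mathbb{C}$ with $g_2\neq 0$, and put $\kappa=\frac{g_1}{\sqrt{2g_2}}$. Consider the $BC_n$-Toda Hamiltonian in $x=(x_1,\dots,x_n)$ $$H^{BC_n}(x)=-\frac12\sum_{i=1}^n\frac{\partial^2}{\partial x_i^2}+g_1e^{x_1}+g_2e^{2x_1}+\sum_{i=1}^{n-1}g_{i+2}e^{x_{i+1}-x_i},$$ the specialized Inozemtsev Hamiltonian in $z=(z_1,\dots,z_{n+1})$ $$H^{I^*_{n+1}}(z)=-\frac12\sum_{i=1}^{n+1}\frac{\partial^2}{\partial z_i^2}-\frac{\kappa}{(e^{-z_1/2}-e^{z_1/2})^2}+\frac{2\kappa(\kappa+1)}{(e^{-z_1}-e^{z_1})^2}+g_3\sqrt{\tfrac{g_2}{2}}\,\bigl(e^{z_1+z_2}+e^{z_2-z_1}\bigr)+\sum_{i=2}^{n}g_{i+2}e^{z_{i+1}-z_i},$$ and the kernel $$Q(x,z)=\left(\frac{1-e^{z_1}}{1+e^{z_1}}\right)^{\kappa}\exp\Bigl\{-\sqrt{\tfrac{g_2}{2}}\bigl(e^{x_1+z_1}+e^{x_1-z_1}\bigr)-\sum_{i=2}^n\bigl(g_{i+1}e^{z_i-x_{i-1}}+e^{x_i-z_i}\bigr)-g_{n+2}e^{z_{n+1}-x_n}\Bigr\}.$$ Then the following intertwining relation holds: $$H^{BC_n}(x)\,Q(x,z)=Q(x,z)\,H^{I^*_{n+1}}(z).$$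
   Context: Convention for intertwining relations: in an identity $H(x)\,Q(x,z)=Q(x,z)\,H'(z)$ the differential operator on the left-hand side acts to the right, on $Q$ as a function of $x$, and the operator on the right-hand side acts to the left, on $Q$ as a function of $z$. Since the operators here are of the form $-\frac12\Delta+$potential (equal to their formal transposes), the relation is the pointwise identity of functions $H(x)[Q(x,z)]=H'(z)[Q(x,z)]$. The identity is understood for $x\in\mathbb{C}^n$, $z\in\mathbb{C}^{n+1}$ with $e^{2z_1}\neq1$, with any local holomorphic branch of the power function. The square roots are chosen consistently: $\sqrt{2g_2}=2\sqrt{g_2/2}$. Empty sums are zero. *)

theory Defs
  imports "HOL-Analysis.Analysis"
begin

text \<open>
  Points of \<open>\<complex>\<^sup>n\<close> and \<open>\<complex>\<^sup>n\<^sup>+\<^sup>1\<close> are functions \<open>nat \<Rightarrow> complex\<close> of which only the coordinates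
  \<open>1, \<dots>, n\<close>, respectively \<open>1, \<dots>, n + 1\<close>, are used; the coupling constants \<open>g\<close> are indexed in
  the same way by \<open>1, \<dots>, n + 2\<close>.
\<close>

definition partial_deriv ::
    "nat \<Rightarrow> ((nat \<Rightarrow> complex) \<Rightarrow> complex) \<Rightarrow> (nat \<Rightarrow> complex) \<Rightarrow> complex" where
  "partial_deriv i F x = deriv (\<lambda>t. F (x(i := t))) (x i)"

definition BC_Toda_hamiltonian ::
    "nat \<Rightarrow> (nat \<Rightarrow> complex) \<Rightarrow> ((nat \<Rightarrow> complex) \<Rightarrow> complex) \<Rightarrow> (nat \<Rightarrow> complex) \<Rightarrow> complex" where
  "BC_Toda_hamiltonian n g F x =
     - (1 / 2) * (\<Sum>i=1..n. (partial_deriv i ^^ 2) F x)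
     + (g 1 * exp (x 1) + g 2 * exp (2 * x 1)
        + (\<Sum>i=1..n - 1. g (i + 2) * exp (x (i + 1) - x i))) * F x"

text \<open>The argument \<open>r\<close> stands for the chosen value of \<open>\<surd>(g\<^sub>2/2)\<close>.\<close>

definition Inozemtsev_hamiltonian ::
    "nat \<Rightarrow> (nat \<Rightarrow> complex) \<Rightarrow> complex \<Rightarrow> complex \<Rightarrow>
      ((nat \<Rightarrow> complex) \<Rightarrow> complex) \<Rightarrow> (nat \<Rightarrow> complex) \<Rightarrow> complex" where
  "Inozemtsev_hamiltonian n g r \<kappa> F z =
     - (1 / 2) * (\<Sum>i=1..n + 1. (partial_deriv i ^^ 2) F z)
     + (- \<kappa> / (exp (- z 1 / 2) - exp (z 1 / 2))^2
        + 2 * \<kappa> * (\<kappa> + 1) / (exp (- z 1) - exp (z 1))^2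
        + g 3 * r * (exp (z 1 + z 2) + exp (z 2 - z 1))
        + (\<Sum>i=2..n. g (i + 2) * exp (z (i + 1) - z i))) * F z"

text \<open>
  A holomorphic branch \<open>p\<close> of \<open>w \<mapsto> w\<^sup>\<kappa>\<close> on the open set \<open>W\<close>, that is, \<open>p = exp (\<kappa> L)\<close> for a
  holomorphic branch \<open>L\<close> of the logarithm; the condition \<open>exp (L w) = w\<close> forces \<open>0 \<notin> W\<close>.
\<close>

definition power_branch :: "complex \<Rightarrow> complex set \<Rightarrow> (complex \<Rightarrow> complex) \<Rightarrow> bool" where
  "power_branch \<kappa> W p \<longleftrightarrow> open W \<and>
     (\<exists>L. L holomorphic_on W \<and> (\<forall>w\<in>W. exp (L w) = w \<and> p w = exp (\<kappa> * L w)))"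

text \<open>The exponent \<open>\<kappa>\<close> enters the kernel through the branch \<open>p\<close> of the power function.\<close>

definition Q_kernel ::
    "nat \<Rightarrow> (nat \<Rightarrow> complex) \<Rightarrow> complex \<Rightarrow> (complex \<Rightarrow> complex) \<Rightarrow>
      (nat \<Rightarrow> complex) \<Rightarrow> (nat \<Rightarrow> complex) \<Rightarrow> complex" where
  "Q_kernel n g r p x z =
     p ((1 - exp (z 1)) / (1 + exp (z 1))) *
     exp (- r * (exp (x 1 + z 1) + exp (x 1 - z 1))
          - (\<Sum>i=2..n. (g (i + 1) * exp (z i - x (i - 1)) + exp (x i - z i)))
          - g (n + 2) * exp (z (n + 1) - x n))"

end

theory Submission
  imports Defs
begin

text \<open>
  In each variable separately the exponent of the kernel has the form
  \<open>c - a exp t - b exp (- t)\<close>, so that every second derivative of \<open>Q\<close> is an explicit multiple of \<open>Q\<close>.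
  Writing the exponent as \<open>- (\<Sum>i. A i + B i)\<close> with \<open>A i\<close>, \<open>B i\<close> proportional to \<open>exp (x i)\<close>,
  \<open>exp (- x i)\<close>, and as \<open>- (\<Sum>i. D i + E i)\<close> with \<open>D i\<close>, \<open>E i\<close> proportional to \<open>exp (z i)\<close>,
  \<open>exp (- z i)\<close>, one has \<open>D (i + 1) = B i\<close>, \<open>E i = A i\<close> for \<open>2 \<le> i \<le> n\<close>, \<open>E (n + 1) = 0\<close> and \<open>A 1 = D 1 + E 1\<close>.
  The squares of the first derivatives therefore differ only in their cross terms, and these are
  the Toda potentials. The factor \<open>((1 - exp t) / (1 + exp t)) powr \<kappa>\<close> has logarithmic derivative
  \<open>\<kappa> / sinh t\<close>; its cross term with \<open>D 1 - E 1\<close> is \<open>g 1 * exp (x 1)\<close>, and its remaining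
  contributions cancel the two singular potentials.
\<close>

section \<open>Second derivatives in separated variables\<close>

lemma partial_deriv_twice:
  "(partial_deriv i ^^ 2) F x = deriv (deriv (\<lambda>t. F (x(i := t)))) (x i)"
proof -
  have "(partial_deriv i ^^ 2) F x = partial_deriv i (partial_deriv i F) x"
    by (simp add: numeral_2_eq_2)
  then show ?thesis
    unfolding partial_deriv_def by simp
qed

text \<open>If \<open>l\<close> is the logarithmic derivative of \<open>f\<close>, then
  \<open>f'' = (l' + l^2) * f\<close>; here \<open>l = u - (a * exp s - b * exp (- s))\<close>. The
  equation for \<open>q\<close> is needed near \<open>t\<close>, not only at \<open>t\<close>,
  because \<open>f'\<close> is differentiated again.\<close>

lemma deriv_deriv_times_exp:
  fixes q u :: "complex \<Rightarrow> complex" and a b c t v :: complex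
  assumes q: "\<forall>\<^sub>F s in nhds t. (q has_field_derivative u s * q s) (at s)"
    and u: "(u has_field_derivative v) (at t)"
  defines "f \<equiv> \<lambda>s. q s * exp (c - (a * exp s + b * exp (- s)))"
  shows "deriv (deriv f) t =
    (v - (a * exp t + b * exp (- t)) + (u t - (a * exp t - b * exp (- t)))^2) * f t"
proof -
  let ?l = "\<lambda>s. u s - (a * exp s - b * exp (- s))"
  have f: "(f has_field_derivative ?l s * f s) (at s)"
    if "(q has_field_derivative u s * q s) (at s)" for s
    unfolding f_def
    by (rule derivative_eq_intros refl that | simp)+ (simp add: algebra_simps)
  have "\<forall>\<^sub>F s in nhds t. deriv f s = ?l s * f s"
    using q by eventually_elim (rule DERIV_imp_deriv, rule f)
  then have "deriv (deriv f) t = deriv (\<lambda>s. ?l s * f s) t"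
    by (intro deriv_cong_ev) auto
  moreover have "((\<lambda>s. ?l s * f s) has_field_derivative
      (v - (a * exp t + b * exp (- t)) + (?l t)^2) * f t) (at t)"
    by (rule derivative_eq_intros refl u f eventually_nhds_x_imp_x[OF q] | simp)+
      (simp add: algebra_simps power2_eq_square)
  ultimately show ?thesis
    by (simp add: DERIV_imp_deriv)
qed

text \<open>Freezing all coordinates except \<open>i\<close> puts the other summands into the
  constant \<open>c\<close>. The prefactor sees only coordinate 1, so \<open>u\<close> and
  \<open>v\<close> enter only for \<open>i = 1\<close>. Both sides of the relation use this, the x
  side with constant \<open>q\<close>.\<close>

lemma partial_deriv_twice_separated:
  fixes q u :: "complex \<Rightarrow> complex" and v :: complex and \<alpha> \<beta> x :: "nat \<Rightarrow> complex"
  assumes I: "finite I" "i \<in> I"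
    and q: "\<forall>\<^sub>F s in nhds (x 1). (q has_field_derivative u s * q s) (at s)"
    and u: "(u has_field_derivative v) (at (x 1))"
  defines "F \<equiv> \<lambda>y. q (y 1) * exp (- (\<Sum>j\<in>I. \<alpha> j * exp (y j) + \<beta> j * exp (- y j)))"
  shows "(partial_deriv i ^^ 2) F x =
    ((if i = 1 then v else 0) - (\<alpha> i * exp (x i) + \<beta> i * exp (- x i))
     + ((if i = 1 then u (x 1) else 0) - (\<alpha> i * exp (x i) - \<beta> i * exp (- x i)))^2) * F x"
proof -
  define c where "c = - (\<Sum>j\<in>I - {i}. \<alpha> j * exp (x j) + \<beta> j * exp (- x j))"
  define q' where "q' = (if i = 1 then q else (\<lambda>_. q (x 1)))"
  define u' where "u' = (if i = 1 then u else (\<lambda>_. 0))"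
  have F: "F (x(i := t)) = q' t * exp (c - (\<alpha> i * exp t + \<beta> i * exp (- t)))" for t
  proof -
    have "- (\<Sum>j\<in>I. \<alpha> j * exp ((x(i := t)) j) + \<beta> j * exp (- (x(i := t)) j)) =
        c - (\<alpha> i * exp t + \<beta> i * exp (- t))"
      unfolding c_def sum.remove[OF I] by (simp add: algebra_simps)
    then show ?thesis
      unfolding F_def q'_def by simp
  qed
  have "\<forall>\<^sub>F s in nhds (x i). (q' has_field_derivative u' s * q' s) (at s)"
    using q by (cases "i = 1") (auto simp: q'_def u'_def)
  moreover have "(u' has_field_derivative (if i = 1 then v else 0)) (at (x i))"
    using u by (auto simp: u'_def)
  ultimately have "deriv (deriv (\<lambda>t. F (x(i := t)))) (x i) =
    ((if i = 1 then v else 0) - (\<alpha> i * exp (x i) + \<beta> i * exp (- x i))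
     + (u' (x i) - (\<alpha> i * exp (x i) - \<beta> i * exp (- x i)))^2) * F (x(i := x i))"
    unfolding F by (rule deriv_deriv_times_exp)
  then show ?thesis
    unfolding partial_deriv_twice by (simp add: u'_def)
qed

section \<open>Logarithmic derivative of the power factor\<close>

lemma power_branch_has_field_derivative:
  assumes "power_branch \<kappa> W p" "w \<in> W"
  shows "(p has_field_derivative \<kappa> / w * p w) (at w)"
proof -
  obtain L where W: "open W" and L: "L holomorphic_on W"
    and exp_L: "\<And>w. w \<in> W \<Longrightarrow> exp (L w) = w"
    and p: "\<And>w. w \<in> W \<Longrightarrow> p w = exp (\<kappa> * L w)"
    using assms(1) unfolding power_branch_def by blast
  have dL: "(L has_field_derivative deriv L w) (at w)"
    using holomorphic_derivI[OF L W assms(2)] .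
  \<comment> \<open>Differentiating \<open>exp (L w) = w\<close> in two ways gives
    \<open>L' = 1 / w\<close>.\<close>
  have "((\<lambda>w. exp (L w)) has_field_derivative deriv L w * w) (at w)"
    by (rule derivative_eq_intros dL refl)+ (simp add: exp_L[OF assms(2)])
  moreover have "((\<lambda>w. exp (L w)) has_field_derivative 1) (at w)"
    by (rule has_field_derivative_transform_within_open[OF DERIV_ident W assms(2)])
      (simp add: exp_L)
  ultimately have "deriv L w * w = 1"
    by (rule DERIV_unique)
  then have dL': "deriv L w = 1 / w"
    by (metis mult_eq_0_iff nonzero_eq_divide_eq zero_neq_one)
  have "((\<lambda>w. exp (\<kappa> * L w)) has_field_derivative \<kappa> / w * p w) (at w)"
    by (rule derivative_eq_intros dL refl)+ (simp add: p[OF assms(2)] dL')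
  then show ?thesis
    by (rule has_field_derivative_transform_within_open[OF _ W assms(2)]) (simp add: p)
qed

lemma exp_double_neq_1:
  fixes t :: complex
  assumes "exp (2 * t) \<noteq> 1"
  shows "1 - exp t \<noteq> 0" "1 + exp t \<noteq> 0" "exp t - exp (- t) \<noteq> 0"
proof -
  have "exp (2 * t) = exp t * exp t"
    by (simp add: exp_double power2_eq_square)
  then have prod: "(1 - exp t) * (1 + exp t) \<noteq> 0"
    using assms by (auto simp: algebra_simps)
  then show "1 - exp t \<noteq> 0" "1 + exp t \<noteq> 0"
    by auto
  have "exp t - exp (- t) = - ((1 - exp t) * (1 + exp t)) / exp t"
    by (simp add: exp_minus field_simps)
  then show "exp t - exp (- t) \<noteq> 0"
    using prod by (metis divide_eq_0_iff exp_not_eq_zero neg_equal_0_iff_equal)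
qed

text \<open>With \<open>w = (1 - exp t) / (1 + exp t)\<close> the chain rule gives the logarithmic
  derivative \<open>\<kappa> * w' / w\<close>, and
  \<open>w' / w = - 2 * exp t / (1 - exp (2 * t)) = 1 / sinh t\<close>.\<close>

lemma power_branch_Cayley_has_field_derivative:
  assumes "power_branch \<kappa> W p" "exp (2 * t) \<noteq> 1" "(1 - exp t) / (1 + exp t) \<in> W"
  shows "((\<lambda>s. p ((1 - exp s) / (1 + exp s))) has_field_derivative
    2 * \<kappa> / (exp t - exp (- t)) * p ((1 - exp t) / (1 + exp t))) (at t)"
proof -
  note nz = exp_double_neq_1[OF assms(2)]
  let ?w = "\<lambda>s::complex. (1 - exp s) / (1 + exp s)"
  have "(?w has_field_derivative - 2 * exp t / (1 + exp t)^2) (at t)"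
    by (rule derivative_eq_intros refl nz)+ (use nz in \<open>simp add: divide_simps power2_eq_square\<close>,
      simp add: algebra_simps)
  from DERIV_chain2[OF power_branch_has_field_derivative[OF assms(1,3)] this]
  have "((\<lambda>s. p (?w s)) has_field_derivative
      \<kappa> / ?w t * (- 2 * exp t / (1 + exp t)^2) * p (?w t)) (at t)"
    by (simp only: mult_ac)
  moreover have "\<kappa> / ?w t * (- 2 * exp t / (1 + exp t)^2) = 2 * \<kappa> / (exp t - exp (- t))"
  proof -
    have 1: "exp t - exp (- t) = - ((1 - exp t) * (1 + exp t)) / exp t"
      by (simp add: exp_minus field_simps)
    have "\<kappa> / (a / b) * (- 2 * e / b^2) = 2 * \<kappa> / (- (a * b) / e)"
      if "a \<noteq> 0" "b \<noteq> 0" "e \<noteq> 0" for a b e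
      using that by (simp add: divide_simps power2_eq_square)
    from this[OF nz(1,2) exp_not_eq_zero] show ?thesis
      unfolding 1 .
  qed
  ultimately show ?thesis
    by (simp only:)
qed

text \<open>Both conditions on \<open>t\<close> are open: \<open>W\<close> is open and the quotient
  is continuous at \<open>t\<close>, where its denominator is nonzero.\<close>

lemma eventually_power_branch_Cayley_derivative:
  assumes p: "power_branch \<kappa> W p" and t: "exp (2 * t) \<noteq> 1" "(1 - exp t) / (1 + exp t) \<in> W"
  shows "\<forall>\<^sub>F s in nhds t. ((\<lambda>s. p ((1 - exp s) / (1 + exp s))) has_field_derivative
    2 * \<kappa> / (exp s - exp (- s)) * p ((1 - exp s) / (1 + exp s))) (at s)"
proof -
  note nz = exp_double_neq_1[OF t(1)]
  let ?w = "\<lambda>s::complex. (1 - exp s) / (1 + exp s)"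
  have "isCont ?w t"
    using nz by (intro continuous_intros) auto
  then have "(?w \<longlongrightarrow> ?w t) (nhds t)"
    using tendsto_at_iff_tendsto_nhds[of ?w t] by (simp add: isCont_def)
  moreover have "open W"
    using p by (simp add: power_branch_def)
  ultimately have "\<forall>\<^sub>F s in nhds t. ?w s \<in> W"
    using t(2) by (rule topological_tendstoD)
  moreover have "\<forall>\<^sub>F s in nhds t. exp (2 * s) \<noteq> 1"
  proof -
    have "open {s::complex. exp (2 * s) \<noteq> 1}"
      by (intro open_Collect_neq continuous_intros)
    then show ?thesis
      using t(1) by (auto simp: eventually_nhds)
  qed
  ultimately show ?thesis
    by eventually_elim (rule power_branch_Cayley_has_field_derivative[OF p])
qed

section \<open>Cancellation of the singular potentials\<close>

lemma inverse_sinh_has_field_derivative: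
  fixes t \<kappa> :: complex
  assumes "exp (2 * t) \<noteq> 1"
  shows "((\<lambda>s. 2 * \<kappa> / (exp s - exp (- s))) has_field_derivative
    - 2 * \<kappa> * (exp t + exp (- t)) / (exp t - exp (- t))^2) (at t)"
  by (rule derivative_eq_intros refl exp_double_neq_1[OF assms] | simp)+
    (use exp_double_neq_1[OF assms] in \<open>simp add: power2_eq_square\<close>)

text \<open>With \<open>u = \<kappa> / sinh t\<close> this says that \<open>- (u' + u\<^sup>2) / 2\<close> cancels the singular potentials.\<close>

lemma singular_potentials_cancel:
  fixes t \<kappa> :: complex
  assumes "exp (2 * t) \<noteq> 1"
  shows "- (1 / 2) * (- 2 * \<kappa> * (exp t + exp (- t)) / (exp t - exp (- t))^2
      + (2 * \<kappa> / (exp t - exp (- t)))^2)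
    + (- \<kappa> / (exp (- t / 2) - exp (t / 2))^2
      + 2 * \<kappa> * (\<kappa> + 1) / (exp (- t) - exp t)^2) = 0"
proof -
  \<comment> \<open>In terms of \<open>y\<close> every exponential is a power, so the claim is a
    rational identity.\<close>
  define y where "y = exp (t / 2)"
  have y0: "y \<noteq> 0" by (simp add: y_def)
  have e: "exp t = y^2" unfolding y_def by (simp flip: exp_double)
  have m: "exp (- t / 2) = 1 / y" "exp (- t) = 1 / y^2"
    unfolding y_def by (simp_all add: exp_minus inverse_eq_divide flip: exp_double)
  have nz: "1 - y^2 \<noteq> 0" "1 + y^2 \<noteq> 0"
    using exp_double_neq_1[OF assms] by (simp_all add: e)
  have 1: "y^2 - 1 / y^2 = - ((1 - y^2) * (1 + y^2)) / y^2"
    "1 / y^2 - y^2 = (1 - y^2) * (1 + y^2) / y^2"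
    "1 / y - y = (1 - y^2) / y"
    "y^2 + 1 / y^2 = (y^4 + 1) / y^2"
    using y0 by (simp_all add: field_simps power2_eq_square power4_eq_xxxx)
  \<comment> \<open>For free \<open>a\<close> and \<open>b\<close> the left side reduces to a
    multiple of \<open>y^4 + 1 + 2 * y^2 - b^2\<close>, which vanishes at
    \<open>b = 1 + y^2\<close>.\<close>
  have "- (1 / 2) * (- 2 * \<kappa> * ((y^4 + 1) / y^2) / (- (a * b) / y^2)^2
      + (2 * \<kappa> / (- (a * b) / y^2))^2) + (- \<kappa> / (a / y)^2 + 2 * \<kappa> * (\<kappa> + 1) / (a * b / y^2)^2)
      = \<kappa> * y^2 * (y^4 + 1 + 2 * y^2 - b^2) / (a * b)^2" if "a \<noteq> 0" "b \<noteq> 0" for a b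
    using that y0 by (simp add: divide_simps) (simp add: algebra_simps power2_eq_square power4_eq_xxxx)
  note this[OF nz]
  also have "y^4 + 1 + 2 * y^2 - (1 + y^2)^2 = 0"
    by (simp add: power2_eq_square power4_eq_xxxx algebra_simps)
  finally show ?thesis
    unfolding e m y_def[symmetric] 1 by simp
qed

section \<open>Interlaced sums\<close>

lemma sum_split_first:
  fixes f :: "nat \<Rightarrow> 'a::comm_monoid_add"
  assumes "n \<ge> 1"
  shows "(\<Sum>i=1..n. f i) = f 1 + (\<Sum>i=2..n. f i)"
  using sum.atLeast_Suc_atMost[OF assms, of f] by (simp add: numeral_2_eq_2)

lemma sum_shift_from_2: "(\<Sum>i=2..n + 1. f i) = (\<Sum>i=1..n. f (i + 1))" for n :: nat
  using sum.shift_bounds_cl_nat_ivl[of f 1 1 n] by (simp add: numeral_2_eq_2)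

text \<open>Expanding the squares, the pure terms in \<open>D\<close> and \<open>E\<close> become
  those in \<open>B\<close> and \<open>A\<close>, except that \<open>A 1\<close> is missing. Only
  the cross terms change: the products \<open>A i * B i\<close> are replaced by the neighbour
  products \<open>B i * A (i + 1)\<close>.\<close>

lemma sum_of_squares_interlaced:
  fixes A B D E :: "nat \<Rightarrow> complex"
  assumes n: "n \<ge> 1"
    and D: "\<And>i. i \<in> {1..n} \<Longrightarrow> D (i + 1) = B i"
    and E: "\<And>i. i \<in> {2..n} \<Longrightarrow> E i = A i" "E (n + 1) = 0"
  shows "(\<Sum>i=2..n + 1. (D i - E i)^2 - (D i + E i)) =
    (\<Sum>i=1..n. (A i - B i)^2 - (A i + B i)) - ((A 1)^2 - A 1) + 2 * A 1 * B 1
    + 2 * (\<Sum>i=2..n. A i * B i) - 2 * (\<Sum>i=1..n - 1. B i * A (i + 1))"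
proof -
  have "(\<Sum>i=2..n + 1. (D i - E i)^2 - (D i + E i)) =
      (\<Sum>i=2..n + 1. (D i)^2 - D i) + (\<Sum>i=2..n + 1. (E i)^2 - E i) - 2 * (\<Sum>i=2..n + 1. D i * E i)"
    by (simp add: sum.distrib sum_subtractf sum_distrib_left power2_diff algebra_simps)
  also have "(\<Sum>i=2..n + 1. (D i)^2 - D i) = (\<Sum>i=1..n. (B i)^2 - B i)"
    unfolding sum_shift_from_2 by (intro sum.cong) (use D in simp_all)
  also have "(\<Sum>i=2..n + 1. (E i)^2 - E i) = (\<Sum>i=2..n. (A i)^2 - A i)"
    using n E by simp
  also have "(\<Sum>i=2..n + 1. D i * E i) = (\<Sum>i=2..n. D i * A i)"
    using n E by simp
  also have "\<dots> = (\<Sum>i=1..n - 1. B i * A (i + 1))"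
    using sum_shift_from_2[of "\<lambda>i. D i * A i" "n - 1"] n D
    by (auto intro!: sum.cong)
  also have "(\<Sum>i=2..n. (A i)^2 - A i) = (\<Sum>i=1..n. (A i)^2 - A i) - ((A 1)^2 - A 1)"
    using sum_split_first[OF n, of "\<lambda>i. (A i)^2 - A i"] by simp
  also have "(\<Sum>i=1..n. (B i)^2 - B i) + ((\<Sum>i=1..n. (A i)^2 - A i) - ((A 1)^2 - A 1)) =
      (\<Sum>i=1..n. (A i - B i)^2 - (A i + B i)) + 2 * (\<Sum>i=1..n. A i * B i) - ((A 1)^2 - A 1)"
    by (simp add: sum.distrib sum_subtractf sum_distrib_left power2_diff algebra_simps)
  also have "(\<Sum>i=1..n. A i * B i) = A 1 * B 1 + (\<Sum>i=2..n. A i * B i)"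
    using sum_split_first[OF n] .
  finally show ?thesis
    by (simp add: algebra_simps)
qed

section \<open>The intertwining relation\<close>

theorem lemma1p2:
  fixes n :: nat and g x z :: "nat \<Rightarrow> complex"
    and r r' \<kappa> :: complex and W :: "complex set" and p :: "complex \<Rightarrow> complex"
  assumes "n \<ge> 1"
    and "g 2 \<noteq> 0"
    and "r^2 = g 2 / 2" and "r'^2 = 2 * g 2" and "r' = 2 * r"
    and "\<kappa> = g 1 / r'"
    and "exp (2 * z 1) \<noteq> 1"
    and "power_branch \<kappa> W p"
    and "(1 - exp (z 1)) / (1 + exp (z 1)) \<in> W"
  shows "BC_Toda_hamiltonian n g (\<lambda>x. Q_kernel n g r p x z) x =
         Inozemtsev_hamiltonian n g r \<kappa> (\<lambda>z. Q_kernel n g r p x z) z"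
proof -
  define P where "P = (\<lambda>t::complex. p ((1 - exp t) / (1 + exp t)))"
  \<comment> \<open>\<open>\<alpha>\<close>, \<open>\<beta>\<close> are the coefficients in minus
    the exponent for fixed z, and \<open>\<gamma>\<close>, \<open>\<delta>\<close> those for fixed
    x. Index 1 carries the boundary term with \<open>r\<close>; \<open>\<delta> (n + 1) = 0\<close>
    since \<open>exp (- z (n + 1))\<close> does not occur.\<close>
  define \<alpha> where "\<alpha> i = (if i = 1 then r * (exp (z 1) + exp (- z 1)) else exp (- z i))" for i
  define \<beta> where "\<beta> i = g (i + 2) * exp (z (i + 1))" for i
  define \<gamma> where "\<gamma> i = (if i = 1 then r * exp (x 1) else g (i + 1) * exp (- x (i - 1)))" for i
  define \<delta> where "\<delta> i = (if i = 1 then r * exp (x 1) else if i \<le> n then exp (x i) else 0)" for i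
  define A where "A i = \<alpha> i * exp (x i)" for i
  define B where "B i = \<beta> i * exp (- x i)" for i
  define D where "D i = \<gamma> i * exp (z i)" for i
  define E where "E i = \<delta> i * exp (- z i)" for i
  define u where "u = 2 * \<kappa> / (exp (z 1) - exp (- z 1))"
  define v where "v = - 2 * \<kappa> * (exp (z 1) + exp (- z 1)) / (exp (z 1) - exp (- z 1))^2"
  define Q where "Q = Q_kernel n g r p x z"

  \<comment> \<open>Shifting the index by one absorbs the separate last term of the kernel into the
    sum, as its summand \<open>i = n\<close>.\<close>
  have Q_form: "Q_kernel n g r p y w = P (w 1) *
      exp (- r * (exp (y 1 + w 1) + exp (y 1 - w 1))
          - (\<Sum>i=1..n. g (i + 2) * exp (w (i + 1) - y i)) - (\<Sum>i=2..n. exp (y i - w i)))" for y w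
  proof -
    have "(\<Sum>i=1..n. g (i + 2) * exp (w (i + 1) - y i)) =
        (\<Sum>i=2..n. g (i + 1) * exp (w i - y (i - 1))) + g (n + 2) * exp (w (n + 1) - y n)"
      using sum_shift_from_2[of "\<lambda>i. g (i + 1) * exp (w i - y (i - 1))" n] assms(1) by simp
    then show ?thesis
      unfolding Q_kernel_def P_def by (simp add: sum.distrib algebra_simps)
  qed

  have Qx: "Q_kernel n g r p y z = P (z 1) *
      exp (- (\<Sum>i\<in>{1..n}. \<alpha> i * exp (y i) + \<beta> i * exp (- y i)))" for y
  proof -
    have "(\<Sum>i=1..n. \<alpha> i * exp (y i)) = \<alpha> 1 * exp (y 1) + (\<Sum>i=2..n. \<alpha> i * exp (y i))"
      using sum_split_first[OF assms(1)] .
    also have "(\<Sum>i=2..n. \<alpha> i * exp (y i)) = (\<Sum>i=2..n. exp (y i - z i))"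
      by (intro sum.cong) (simp_all add: \<alpha>_def flip: exp_add)
    also have "\<alpha> 1 * exp (y 1) = r * (exp (y 1 + z 1) + exp (y 1 - z 1))"
      by (simp add: \<alpha>_def exp_add exp_diff exp_minus field_simps)
    finally show ?thesis
      unfolding Q_form sum.distrib
      by (simp add: \<beta>_def exp_diff exp_minus divide_inverse algebra_simps)
  qed

  have Qz: "Q_kernel n g r p x w = P (w 1) *
      exp (- (\<Sum>i\<in>{1..n + 1}. \<gamma> i * exp (w i) + \<delta> i * exp (- w i)))" for w
  proof -
    have "(\<Sum>i=1..n + 1. \<gamma> i * exp (w i)) = \<gamma> 1 * exp (w 1) + (\<Sum>i=2..n + 1. \<gamma> i * exp (w i))"
      by (rule sum_split_first) simp
    also have "(\<Sum>i=2..n + 1. \<gamma> i * exp (w i)) = (\<Sum>i=1..n. g (i + 2) * exp (w (i + 1) - x i))"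
      unfolding sum_shift_from_2
      by (intro sum.cong) (simp_all add: \<gamma>_def exp_diff exp_minus divide_inverse)
    finally have 1: "(\<Sum>i=1..n + 1. \<gamma> i * exp (w i)) =
      r * exp (x 1 + w 1) + (\<Sum>i=1..n. g (i + 2) * exp (w (i + 1) - x i))"
      by (simp add: \<gamma>_def exp_add)
    have "(\<Sum>i=1..n + 1. \<delta> i * exp (- w i)) = (\<Sum>i=1..n. \<delta> i * exp (- w i))"
      using assms(1) by (simp add: \<delta>_def)
    also have "\<dots> = \<delta> 1 * exp (- w 1) + (\<Sum>i=2..n. \<delta> i * exp (- w i))"
      using sum_split_first[OF assms(1)] .
    also have "(\<Sum>i=2..n. \<delta> i * exp (- w i)) = (\<Sum>i=2..n. exp (x i - w i))"
      by (intro sum.cong) (simp_all add: \<delta>_def flip: exp_add)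
    finally have 2: "(\<Sum>i=1..n + 1. \<delta> i * exp (- w i)) =
        r * exp (x 1 - w 1) + (\<Sum>i=2..n. exp (x i - w i))"
      by (simp add: \<delta>_def exp_diff exp_minus divide_inverse)
    show ?thesis
      unfolding Q_form sum.distrib 1 2 by (simp add: algebra_simps)
  qed

  have ddx: "(partial_deriv i ^^ 2) (\<lambda>y. Q_kernel n g r p y z) x =
      ((A i - B i)^2 - (A i + B i)) * Q" if "i \<in> {1..n}" for i
  proof -
    have "(partial_deriv i ^^ 2) (\<lambda>y. Q_kernel n g r p y z) x =
      ((if i = 1 then 0 else 0) - (A i + B i) + ((if i = 1 then 0 else 0) - (A i - B i))^2) * Q"
      unfolding Q_def Qx A_def B_def
      by (rule partial_deriv_twice_separated[where q = "\<lambda>_. P (z 1)" and u = "\<lambda>_. 0"])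
        (use that in auto)
    then show ?thesis
      by (simp add: power2_commute)
  qed
  have ddz: "(partial_deriv i ^^ 2) (\<lambda>w. Q_kernel n g r p x w) z =
      ((if i = 1 then v else 0) - (D i + E i) + ((if i = 1 then u else 0) - (D i - E i))^2) * Q"
    if "i \<in> {1..n + 1}" for i
    unfolding Q_def Qz D_def E_def u_def v_def
    by (rule partial_deriv_twice_separated
          [where q = P and x = z and u = "\<lambda>s. 2 * \<kappa> / (exp s - exp (- s))"])
      (use that inverse_sinh_has_field_derivative[OF assms(7)]
        eventually_power_branch_Cayley_derivative[OF assms(8,7,9)] in \<open>simp_all add: P_def\<close>)

  have D_shift: "D (i + 1) = B i" if "i \<in> {1..n}" for i
    using that by (simp add: D_def B_def \<gamma>_def \<beta>_def)
  have E_eq: "E i = A i" if "i \<in> {2..n}" for i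
    using that by (simp add: E_def A_def \<delta>_def \<alpha>_def)
  have E_last: "E (n + 1) = 0"
    using assms(1) by (simp add: E_def \<delta>_def)
  have A1: "A 1 = D 1 + E 1"
    by (simp add: A_def D_def E_def \<alpha>_def \<gamma>_def \<delta>_def algebra_simps)
  have D1_E1: "D 1 * E 1 = g 2 / 2 * exp (2 * x 1)"
    unfolding assms(3)[symmetric]
    by (simp add: D_def E_def \<gamma>_def \<delta>_def exp_minus exp_double power2_eq_square)
  \<comment> \<open>The factor \<open>exp (z 1) - exp (- z 1)\<close> cancels the denominator of
    \<open>u\<close>, leaving \<open>2 * \<kappa> * r * exp (x 1)\<close>; the value of
    \<open>\<kappa>\<close> and \<open>r' = 2 * r\<close> turn this into the linear
    potential.\<close>
  have cross: "u * (D 1 - E 1) = g 1 * exp (x 1)"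
  proof -
    have "r \<noteq> 0" using assms(2,3) by auto
    moreover have "D 1 - E 1 = r * exp (x 1) * (exp (z 1) - exp (- z 1))"
      by (simp add: D_def E_def \<gamma>_def \<delta>_def algebra_simps)
    ultimately show ?thesis
      using exp_double_neq_1(3)[OF assms(7)] by (simp add: u_def assms(5,6))
  qed
  \<comment> \<open>Neighbour products lose their dependence on \<open>z (i + 1)\<close>, and
    products at one index their dependence on \<open>x i\<close>; these are the two Toda
    chains.\<close>
  have toda_x: "(\<Sum>i=1..n - 1. g (i + 2) * exp (x (i + 1) - x i)) = (\<Sum>i=1..n - 1. B i * A (i + 1))"
    by (intro sum.cong) (simp_all add: A_def B_def \<alpha>_def \<beta>_def exp_diff exp_minus field_simps)
  have toda_z: "(\<Sum>i=2..n. g (i + 2) * exp (z (i + 1) - z i)) = (\<Sum>i=2..n. A i * B i)"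
    by (intro sum.cong) (simp_all add: A_def B_def \<alpha>_def \<beta>_def exp_diff exp_minus field_simps)
  have A1_B1: "g 3 * r * (exp (z 1 + z 2) + exp (z 2 - z 1)) = A 1 * B 1"
    by (simp add: A_def B_def \<alpha>_def \<beta>_def exp_add exp_diff exp_minus field_simps
        numeral_2_eq_2 numeral_3_eq_3)

  define X where "X = (\<Sum>i=2..n. A i * B i)"
  define Y where "Y = (\<Sum>i=1..n - 1. B i * A (i + 1))"
  define S where "S = (\<Sum>i=1..n. (A i - B i)^2 - (A i + B i))"
  define U where "U = - \<kappa> / (exp (- z 1 / 2) - exp (z 1 / 2))^2
        + 2 * \<kappa> * (\<kappa> + 1) / (exp (- z 1) - exp (z 1))^2"
  have sum_x: "(\<Sum>i=1..n. (partial_deriv i ^^ 2) (\<lambda>y. Q_kernel n g r p y z) x) = S * Q"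
    by (simp add: ddx S_def sum_distrib_right)
  have sum_z: "(\<Sum>i=1..n + 1. (partial_deriv i ^^ 2) (\<lambda>w. Q_kernel n g r p x w) z) =
      (v - A 1 + (u - (D 1 - E 1))^2 + (S - ((A 1)^2 - A 1) + 2 * A 1 * B 1
        + 2 * X - 2 * Y)) * Q"
  proof -
    have "(\<Sum>i=1..n + 1. (partial_deriv i ^^ 2) (\<lambda>w. Q_kernel n g r p x w) z) =
      (v - (D 1 + E 1) + (u - (D 1 - E 1))^2) * Q
        + (\<Sum>i=2..n + 1. (partial_deriv i ^^ 2) (\<lambda>w. Q_kernel n g r p x w) z)"
      by (subst sum_split_first) (simp_all add: ddz)
    also have "(\<Sum>i=2..n + 1. (partial_deriv i ^^ 2) (\<lambda>w. Q_kernel n g r p x w) z) =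
        (\<Sum>i=2..n + 1. (D i - E i)^2 - (D i + E i)) * Q"
      unfolding sum_distrib_right
      by (intro sum.cong refl) (subst ddz, simp_all add: power2_commute)
    also have "(\<Sum>i=2..n + 1. (D i - E i)^2 - (D i + E i)) = S - ((A 1)^2 - A 1) + 2 * A 1 * B 1
        + 2 * X - 2 * Y"
      unfolding S_def X_def Y_def
      by (rule sum_of_squares_interlaced[OF assms(1), where A = A and B = B])
        (use D_shift E_eq E_last in simp_all)
    finally show ?thesis
      unfolding A1 by (simp only: distrib_right)
  qed
  have UV: "- (1 / 2) * (v + u^2) + U = 0"
    unfolding u_def v_def U_def by (rule singular_potentials_cancel[OF assms(7)])
  have g2: "g 2 * exp (2 * x 1) = 2 * (D 1 * E 1)"
    unfolding D1_E1 by simp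
  have "- (1 / 2) * S + (g 1 * exp (x 1) + g 2 * exp (2 * x 1) + Y) =
      - (1 / 2) * (v - A 1 + (u - (D 1 - E 1))^2 + (S - ((A 1)^2 - A 1) + 2 * A 1 * B 1
        + 2 * X - 2 * Y))
      + (U + A 1 * B 1 + X)" (is "?l = ?r")
  proof -
    \<comment> \<open>\<open>X\<close>, \<open>A 1 * B 1\<close> and the linear terms in
      \<open>A 1\<close> drop out. Since \<open>A 1 = D 1 + E 1\<close>, the difference of squares
      is \<open>4 * D 1 * E 1\<close>, and half of it is the potential
      \<open>g 2 * exp (2 * x 1)\<close>.\<close>
    have "?r = - (1 / 2) * (v + u^2) + U - (1 / 2) * S + u * (D 1 - E 1)
        + (1 / 2) * ((A 1)^2 - (D 1 - E 1)^2) + Y"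
      by algebra
    then show ?thesis
      unfolding UV cross g2 A1 by algebra
  qed
  from arg_cong[OF this, of "\<lambda>a. a * Q"] show ?thesis
    unfolding BC_Toda_hamiltonian_def Inozemtsev_hamiltonian_def sum_x sum_z toda_x toda_z A1_B1
    unfolding Q_def[symmetric] U_def[symmetric] X_def[symmetric] Y_def[symmetric]
    by (simp only: distrib_right mult.assoc)
qed

end
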